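(* Let $f\colon S^1\to S^1$ be an irrational rotation and let $T\colon S^1\to\mathbb{R}^+$ be a $C^1$ function. Then the suspension of $f$ with return time function $T$ is not kinematic expansive.
   Context: Given a homeomorphism $f\colon l\to l$ of a compact metric space and a continuous return time function $T\colon l\to\mathbb{R}^+=(0,\infty)$, the suspension of $f$ with return time $T$ is the flow on the quotient of $\{(x,t):x\in l,\ 0\le t\le T(x)\}$ by $(x,T(x))\sim(f(x),0)$ that moves points along the second coordinate at unit speed. A continuous flow $\phi$ on a compact metric space is kinematic expansive if for all $\epsilon>0$ there exists $\delta>0$ such that if $\operatorname{dist}(\phi_t(x),\phi_t(y))<\delta$ for all $t\in\mathbb{R}$ then there exists $s\in\mathbb{R}$ with $|s|<\epsilon$ and $y=\phi_s(x)$ (this does not depend on the metric inducing the topology). *)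

theory Defs
  imports "HOL-Analysis.Analysis"
begin

definition quotient_topology :: "'a topology \<Rightarrow> ('a \<times> 'a) set \<Rightarrow> 'a set topology" where
  "quotient_topology X r = topology
     (\<lambda>U. U \<subseteq> topspace X // r \<and> openin X {x \<in> topspace X. r `` {x} \<in> U})"

lemma openin_quotient_topology:
  "openin (quotient_topology X r) U \<longleftrightarrow>
     U \<subseteq> topspace X // r \<and> openin X {x \<in> topspace X. r `` {x} \<in> U}"
proof -
  have "istopology (\<lambda>U. U \<subseteq> topspace X // r \<and> openin X {x \<in> topspace X. r `` {x} \<in> U})"
    unfolding istopology_def
  proof (rule conjI; intro allI impI)
    fix S S' assume *: "S \<subseteq> topspace X // r \<and> openin X {x \<in> topspace X. r `` {x} \<in> S}"
      "S' \<subseteq> topspace X // r \<and> openin X {x \<in> topspace X. r `` {x} \<in> S'}"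
    have "{x \<in> topspace X. r `` {x} \<in> S \<inter> S'} =
      {x \<in> topspace X. r `` {x} \<in> S} \<inter> {x \<in> topspace X. r `` {x} \<in> S'}" by auto
    then show "S \<inter> S' \<subseteq> topspace X // r \<and> openin X {x \<in> topspace X. r `` {x} \<in> S \<inter> S'}"
      using * openin_Int[of X] by auto
  next
    fix K assume *: "\<forall>S\<in>K. S \<subseteq> topspace X // r \<and> openin X {x \<in> topspace X. r `` {x} \<in> S}"
    have "{x \<in> topspace X. r `` {x} \<in> \<Union>K} =
      \<Union>((\<lambda>S. {x \<in> topspace X. r `` {x} \<in> S}) ` K)" by auto
    then show "\<Union>K \<subseteq> topspace X // r \<and> openin X {x \<in> topspace X. r `` {x} \<in> \<Union>K}"
      using * by (auto simp del: Union_iff intro!: openin_Union)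
  qed
  then show ?thesis
    by (simp add: quotient_topology_def topology_inverse')
qed

lemma topspace_quotient_topology [simp]:
  "topspace (quotient_topology X r) = topspace X // r"
proof -
  have "{x \<in> topspace X. r `` {x} \<in> topspace X // r} = topspace X"
    by (auto intro: quotientI)
  then have "openin (quotient_topology X r) (topspace X // r)"
    by (simp add: openin_quotient_topology)
  then show ?thesis
    by (meson openin_subset openin_topspace openin_quotient_topology subset_antisym)
qed

lemma quotient_map_quotient_topology:
  "quotient_map X (quotient_topology X r) (\<lambda>x. r `` {x})"
  unfolding quotient_map_def by (auto simp: openin_quotient_topology quotient_def)

definition suspension_domain :: "'a topology \<Rightarrow> ('a \<Rightarrow> real) \<Rightarrow> ('a \<times> real) set" where
  "suspension_domain X T = {(x, t). x \<in> topspace X \<and> 0 \<le> t \<and> t \<le> T x}"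

definition suspension_rel ::
  "'a topology \<Rightarrow> ('a \<Rightarrow> 'a) \<Rightarrow> ('a \<Rightarrow> real) \<Rightarrow> (('a \<times> real) \<times> ('a \<times> real)) set" where
  "suspension_rel X f T =
     {(p, q). p \<in> suspension_domain X T \<and> q \<in> suspension_domain X T \<and>
        equivclp (\<lambda>p q. \<exists>x \<in> topspace X. p = (x, T x) \<and> q = (f x, 0)) p q}"

definition suspension_topology ::
  "'a topology \<Rightarrow> ('a \<Rightarrow> 'a) \<Rightarrow> ('a \<Rightarrow> real) \<Rightarrow> ('a \<times> real) set topology" where
  "suspension_topology X f T =
     quotient_topology
       (subtopology (prod_topology X euclideanreal) (suspension_domain X T))
       (suspension_rel X f T)"

definition birkhoff_sum :: "('a \<Rightarrow> 'a) \<Rightarrow> ('a \<Rightarrow> real) \<Rightarrow> nat \<Rightarrow> 'a \<Rightarrow> real" where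
  "birkhoff_sum f T n x = (\<Sum>i<n. T ((f ^^ i) x))"

(* Equality of (x, s) and (y, u) modulo the identifications (x, s + T x) ~ (f x, s) on l x R:
   y = f^n x after crossing the roof n times, or the same with the two points exchanged. *)
definition suspension_orbit_eq ::
  "('a \<Rightarrow> 'a) \<Rightarrow> ('a \<Rightarrow> real) \<Rightarrow> 'a \<times> real \<Rightarrow> 'a \<times> real \<Rightarrow> bool" where
  "suspension_orbit_eq f T = (\<lambda>(x, s) (y, u).
     \<exists>n. (f ^^ n) x = y \<and> s = birkhoff_sum f T n x + u \<or>
         (f ^^ n) y = x \<and> u = birkhoff_sum f T n y + s)"

(* The point with representative (x, s) moves to (x, s + t), which is brought back into the
   domain by the identifications above. The value is the set of all its representatives there,
   that is, a point of the quotient (see suspension_flow_class). *)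
definition suspension_flow ::
  "'a topology \<Rightarrow> ('a \<Rightarrow> 'a) \<Rightarrow> ('a \<Rightarrow> real) \<Rightarrow> real \<Rightarrow> ('a \<times> real) set \<Rightarrow> ('a \<times> real) set" where
  "suspension_flow X f T t P =
     {q \<in> suspension_domain X T. \<exists>(x, s) \<in> P. suspension_orbit_eq f T (x, s + t) q}"

(* This is a condition on a flow on the compact metric space (M, d); that (M, d) is one and
   that \<phi> is a flow on it are not part of the definition, so that they cannot be what fails
   when it is negated. *)
definition kinematic_expansive ::
  "'a set \<Rightarrow> ('a \<Rightarrow> 'a \<Rightarrow> real) \<Rightarrow> (real \<Rightarrow> 'a \<Rightarrow> 'a) \<Rightarrow> bool" where
  "kinematic_expansive M d \<phi> \<longleftrightarrow>
     (\<forall>\<epsilon>>0. \<exists>\<delta>>0. \<forall>x\<in>M. \<forall>y\<in>M.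
        (\<forall>t. d (\<phi> t x) (\<phi> t y) < \<delta>) \<longrightarrow> (\<exists>s. \<bar>s\<bar> < \<epsilon> \<and> y = \<phi> s x))"

definition circle_rotation :: "real \<Rightarrow> complex \<Rightarrow> complex" where
  "circle_rotation \<alpha> z = cis (2 * pi * \<alpha>) * z"

abbreviation circle :: "complex topology" where
  "circle \<equiv> top_of_set (sphere 0 1)"

lemma birkhoff_sum_add:
  "birkhoff_sum f T (m + n) x = birkhoff_sum f T m x + birkhoff_sum f T n ((f ^^ m) x)"
proof (induction n)
  case (Suc n)
  have "(f ^^ (m + n)) x = (f ^^ n) ((f ^^ m) x)"
    by (metis add.commute comp_apply funpow_add)
  with Suc show ?case by (simp add: birkhoff_sum_def)
qed (simp add: birkhoff_sum_def)

locale suspension =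
  fixes X :: "'a topology" and f :: "'a \<Rightarrow> 'a" and T :: "'a \<Rightarrow> real"
  assumes bij: "bij_betw f (topspace X) (topspace X)"
    and bounded_below: "\<exists>c>0. \<forall>x\<in>topspace X. c \<le> T x"
begin

lemma T_pos: "x \<in> topspace X \<Longrightarrow> 0 < T x"
  using bounded_below by force

lemma funpow_bij: "bij_betw (f ^^ n) (topspace X) (topspace X)"
proof (induction n)
  case (Suc n)
  then show ?case using bij_betw_trans[OF Suc bij] by (simp add: comp_def)
qed (simp add: bij_betw_def)

lemma funpow_in: "x \<in> topspace X \<Longrightarrow> (f ^^ n) x \<in> topspace X"
  using funpow_bij bij_betwE by blast

lemma funpow_eqD:
  "\<lbrakk>(f ^^ n) x = (f ^^ n) y; x \<in> topspace X; y \<in> topspace X\<rbrakk> \<Longrightarrow> x = y"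
  using funpow_bij[of n] by (auto simp: bij_betw_def dest: inj_onD)

lemma orbit_eq_refl: "suspension_orbit_eq f T p p"
  by (auto simp: suspension_orbit_eq_def birkhoff_sum_def split: prod.splits intro!: exI[of _ 0])

lemma orbit_eq_sym: "suspension_orbit_eq f T p q \<Longrightarrow> suspension_orbit_eq f T q p"
  by (auto simp: suspension_orbit_eq_def split: prod.splits)

lemma orbit_eq_shift:
  "suspension_orbit_eq f T (x, s) (y, u) \<Longrightarrow> suspension_orbit_eq f T (x, s + t) (y, u + t)"
  by (fastforce simp: suspension_orbit_eq_def)

lemma orbit_eqI:
  assumes "x \<in> topspace X" "y \<in> topspace X" "(f ^^ n) x = (f ^^ m) y"
    "s - birkhoff_sum f T n x = u - birkhoff_sum f T m y"
  shows "suspension_orbit_eq f T (x, s) (y, u)"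
proof (cases "m \<le> n")
  case True
  then obtain k where n: "n = k + m" by (metis add.commute le_Suc_ex)
  then have "(f ^^ m) ((f ^^ k) x) = (f ^^ m) y"
    using assms(3) by (metis add.commute comp_apply funpow_add)
  then have "(f ^^ k) x = y" using funpow_eqD assms funpow_in by blast
  moreover from this have "s = birkhoff_sum f T k x + u"
    using assms(4) by (simp add: n birkhoff_sum_add)
  ultimately show ?thesis by (auto simp: suspension_orbit_eq_def)
next
  case False
  then obtain k where n: "m = k + n" by (metis add.commute le_Suc_ex nle_le)
  then have "(f ^^ n) ((f ^^ k) y) = (f ^^ n) x"
    using assms(3) by (metis add.commute comp_apply funpow_add)
  then have "(f ^^ k) y = x" using funpow_eqD assms funpow_in by blast
  moreover from this have "u = birkhoff_sum f T k y + s"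
    using assms(4) by (simp add: n birkhoff_sum_add)
  ultimately show ?thesis by (auto simp: suspension_orbit_eq_def)
qed

lemma orbit_eqE:
  assumes "suspension_orbit_eq f T (x, s) (y, u)"
  obtains n m where "(f ^^ n) x = (f ^^ m) y"
    "s - birkhoff_sum f T n x = u - birkhoff_sum f T m y"
proof -
  obtain k where "(f ^^ k) x = y \<and> s = birkhoff_sum f T k x + u \<or>
         (f ^^ k) y = x \<and> u = birkhoff_sum f T k y + s"
    using assms by (auto simp: suspension_orbit_eq_def)
  then show thesis
  proof
    assume "(f ^^ k) x = y \<and> s = birkhoff_sum f T k x + u"
    then show thesis by (intro that[of k 0]) (auto simp: birkhoff_sum_def)
  next
    assume "(f ^^ k) y = x \<and> u = birkhoff_sum f T k y + s"
    then show thesis by (intro that[of 0 k]) (auto simp: birkhoff_sum_def)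
  qed
qed

lemma orbit_eq_trans:
  assumes "x \<in> topspace X" "y \<in> topspace X" "z \<in> topspace X"
    and "suspension_orbit_eq f T (x, s) (y, u)" "suspension_orbit_eq f T (y, u) (z, v)"
  shows "suspension_orbit_eq f T (x, s) (z, v)"
proof -
  obtain n m where 1: "(f ^^ n) x = (f ^^ m) y"
    "s - birkhoff_sum f T n x = u - birkhoff_sum f T m y" using assms(4) by (rule orbit_eqE)
  obtain k l where 2: "(f ^^ k) y = (f ^^ l) z"
    "u - birkhoff_sum f T k y = v - birkhoff_sum f T l z" using assms(5) by (rule orbit_eqE)
  have a: "(f ^^ (n + k)) x = (f ^^ (m + k)) y"
    by (metis 1(1) add.commute comp_apply funpow_add)
  have b: "(f ^^ (k + m)) y = (f ^^ (l + m)) z"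
    by (metis 2(1) add.commute comp_apply funpow_add)
  have c: "birkhoff_sum f T (n + k) x - birkhoff_sum f T (m + k) y = s - u"
    using 1 by (simp add: birkhoff_sum_add)
  have d: "birkhoff_sum f T (k + m) y - birkhoff_sum f T (l + m) z = u - v"
    using 2 by (simp add: birkhoff_sum_add)
  show ?thesis
  proof (rule orbit_eqI[OF assms(1,3)])
    show "(f ^^ (n + k)) x = (f ^^ (l + m)) z" using a b by (simp only: add.commute[of m k])
    show "s - birkhoff_sum f T (n + k) x = v - birkhoff_sum f T (l + m) z"
      using c d unfolding add.commute[of m k] by linarith
  qed
qed

lemma glue_orbit_eq:
  "suspension_orbit_eq f T (x, T x) (f x, 0)"
  unfolding suspension_orbit_eq_def by (auto simp: birkhoff_sum_def intro!: exI[of _ 1])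

lemma orbit_eq_domain:
  assumes "(x, s) \<in> suspension_domain X T" "(y, u) \<in> suspension_domain X T"
    and "(f ^^ n) x = y" "s = birkhoff_sum f T n x + u"
  shows "(x, s) = (y, u) \<or> s = T x \<and> (y, u) = (f x, 0)"
proof (cases n)
  case 0
  then show ?thesis using assms by (simp add: birkhoff_sum_def)
next
  case (Suc k)
  have x: "x \<in> topspace X" and s: "s \<le> T x" and u: "0 \<le> u"
    using assms by (auto simp: suspension_domain_def)
  have eq: "birkhoff_sum f T n x = T x + birkhoff_sum f T k (f x)"
    using birkhoff_sum_add[of f T 1 k x] by (simp add: Suc birkhoff_sum_def)
  have pos: "\<And>i. T ((f ^^ i) (f x)) > 0"
    using T_pos funpow_in x by (metis funpow_swap1 bij bij_betwE)
  have "k = 0"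
  proof (rule ccontr)
    assume "k \<noteq> 0"
    then have "birkhoff_sum f T k (f x) > 0"
      unfolding birkhoff_sum_def by (intro sum_pos) (use pos in auto)
    with eq s u assms(4) show False by simp
  qed
  then show ?thesis using assms eq s u Suc by (auto simp: birkhoff_sum_def)
qed

lemma suspension_rel_iff:
  "(p, q) \<in> suspension_rel X f T \<longleftrightarrow>
     p \<in> suspension_domain X T \<and> q \<in> suspension_domain X T \<and> suspension_orbit_eq f T p q"
proof -
  let ?g = "\<lambda>p q. \<exists>x \<in> topspace X. p = (x, T x) \<and> q = (f x, 0)"
  have fwd: "fst q \<in> topspace X \<and> suspension_orbit_eq f T p q"
    if "equivclp ?g p q" "fst p \<in> topspace X" for p q
    using that
  proof (induction rule: equivclp_induct)
    case base
    then show ?case by (simp add: orbit_eq_refl)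
  next
    case (step y z)
    have fx: "\<And>x. x \<in> topspace X \<Longrightarrow> f x \<in> topspace X" using bij bij_betwE by blast
    have yz: "suspension_orbit_eq f T y z" and z: "fst z \<in> topspace X"
      using step(2) glue_orbit_eq orbit_eq_sym fx by auto
    have "suspension_orbit_eq f T p z"
      using orbit_eq_trans[of "fst p" "fst y" "fst z" "snd p" "snd y" "snd z"] step yz z by simp
    then show ?case using z by simp
  qed
  have bwd: "equivclp ?g p q"
    if D: "p \<in> suspension_domain X T" "q \<in> suspension_domain X T"
      and E: "suspension_orbit_eq f T p q" for p q
  proof -
    obtain x s y u where p: "p = (x, s)" and q: "q = (y, u)" by fastforce
    have xy: "x \<in> topspace X" "y \<in> topspace X"
      using D by (auto simp: p q suspension_domain_def)
    from E obtain n where "(f ^^ n) x = y \<and> s = birkhoff_sum f T n x + u \<or>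
         (f ^^ n) y = x \<and> u = birkhoff_sum f T n y + s"
      by (auto simp: suspension_orbit_eq_def p q)
    then have "((x, s) = (y, u) \<or> s = T x \<and> (y, u) = (f x, 0)) \<or>
        ((y, u) = (x, s) \<or> u = T y \<and> (x, s) = (f y, 0))"
      using orbit_eq_domain[of x s y u n] orbit_eq_domain[of y u x s n] D[unfolded p q] by blast
    then have "p = q \<or> ?g p q \<or> ?g q p"
      using xy by (auto simp: p q)
    then show ?thesis
    proof (elim disjE)
      assume "?g p q" then show ?thesis by (rule r_into_equivclp)
    next
      assume "?g q p" then show ?thesis by (intro equivclp_sym[OF r_into_equivclp])
    qed simp
  qed
  show ?thesis
    using fwd[of p q] bwd[of p q] by (auto simp: suspension_rel_def suspension_domain_def)
qed

lemma equiv_suspension_rel: "equiv (suspension_domain X T) (suspension_rel X f T)"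
proof (rule equivI)
  show "suspension_rel X f T \<subseteq> suspension_domain X T \<times> suspension_domain X T"
    by (auto simp: suspension_rel_iff)
  show "refl_on (suspension_domain X T) (suspension_rel X f T)"
    by (auto simp: refl_on_def suspension_rel_iff orbit_eq_refl)
  show "sym (suspension_rel X f T)"
    by (auto simp: sym_def suspension_rel_iff orbit_eq_sym)
  show "trans (suspension_rel X f T)"
    unfolding trans_def suspension_rel_iff
    by (auto simp: suspension_domain_def intro: orbit_eq_trans)
qed

lemma orbit_eq_domain_exists:
  assumes x: "x \<in> topspace X"
  shows "\<exists>q \<in> suspension_domain X T. suspension_orbit_eq f T (x, s) q"
proof -
  obtain c where c: "c > 0" "\<And>x. x \<in> topspace X \<Longrightarrow> c \<le> T x" using bounded_below by auto
  have pos: "\<exists>q \<in> suspension_domain X T. suspension_orbit_eq f T (x, s) q"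
    if "x \<in> topspace X" "0 \<le> s" "s \<le> real n * c" for x s n
    using that
  proof (induction n arbitrary: x s)
    case 0
    then show ?case
      using T_pos orbit_eq_refl by (intro bexI[of _ "(x, s)"])
        (auto simp: suspension_domain_def less_imp_le)
  next
    case (Suc n)
    show ?case
    proof (cases "s \<le> T x")
      case True
      then show ?thesis using Suc orbit_eq_refl
        by (intro bexI[of _ "(x, s)"]) (auto simp: suspension_domain_def)
    next
      case False
      have fx: "f x \<in> topspace X" using Suc bij bij_betwE by blast
      have "s - T x \<le> real n * c" using c(2)[OF Suc(2)] Suc(4) by (simp add: algebra_simps)
      then obtain y u where q: "(y, u) \<in> suspension_domain X T"
        "suspension_orbit_eq f T (f x, s - T x) (y, u)"
        using Suc.IH[OF fx, of "s - T x"] False by auto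
      have "suspension_orbit_eq f T (x, s) (f x, s - T x)"
        using orbit_eq_shift[OF glue_orbit_eq, of x "s - T x"] by simp
      then have "suspension_orbit_eq f T (x, s) (y, u)"
        using orbit_eq_trans[OF Suc(2) fx _ _ q(2)] q(1) by (auto simp: suspension_domain_def)
      then show ?thesis using q by auto
    qed
  qed
  have neg: "\<exists>y u. y \<in> topspace X \<and> 0 \<le> u \<and> suspension_orbit_eq f T (x, s) (y, u)"
    if "x \<in> topspace X" "- s \<le> real n * c" for x s n
    using that
  proof (induction n arbitrary: x s)
    case 0
    then show ?case
      by (intro exI[of _ x] exI[of _ s] conjI orbit_eq_refl) (auto simp: mult_less_0_iff)
  next
    case (Suc n)
    obtain w where w: "w \<in> topspace X" "f w = x"
      using Suc bij by (metis bij_betw_imp_surj_on imageE)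
    have "- (s + T w) \<le> real n * c" using c(2)[OF w(1)] Suc(3) by (simp add: algebra_simps)
    then obtain y u where q: "y \<in> topspace X" "0 \<le> u"
      "suspension_orbit_eq f T (w, s + T w) (y, u)"
      using Suc.IH[OF w(1)] by blast
    have "suspension_orbit_eq f T (w, s + T w) (x, s)"
      using orbit_eq_shift[OF glue_orbit_eq, of w s] w by (simp add: add.commute)
    then have "suspension_orbit_eq f T (x, s) (y, u)"
      using orbit_eq_trans[OF Suc(2) w(1) q(1) _ q(3)] orbit_eq_sym by blast
    then show ?case using q by auto
  qed
  obtain m where m: "- s < real m * c" using reals_Archimedean3[OF c(1)] by blast
  then obtain y u where y: "y \<in> topspace X" "0 \<le> u" "suspension_orbit_eq f T (x, s) (y, u)"
    using neg[OF x, of s m] by auto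
  obtain n where n: "u < real n * c" using reals_Archimedean3[OF c(1)] by blast
  obtain z v where z: "(z, v) \<in> suspension_domain X T" "suspension_orbit_eq f T (y, u) (z, v)"
    using pos[OF y(1,2), of n] n by auto
  then have "z \<in> topspace X" by (auto simp: suspension_domain_def)
  then show ?thesis using z orbit_eq_trans[OF x y(1) _ y(3) z(2)] by blast
qed

lemma suspension_flow_class:
  assumes xs: "(x, s) \<in> suspension_domain X T" and yu: "(y, u) \<in> suspension_domain X T"
    and eq: "suspension_orbit_eq f T (x, s + t) (y, u)"
  shows "suspension_flow X f T t (suspension_rel X f T `` {(x, s)}) = suspension_rel X f T `` {(y, u)}"
proof -
  have xt: "x \<in> topspace X" and yt: "y \<in> topspace X"
    using xs yu by (auto simp: suspension_domain_def)
  have "(\<exists>(x', s') \<in> suspension_rel X f T `` {(x, s)}. suspension_orbit_eq f T (x', s' + t) (z, v))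
        \<longleftrightarrow> suspension_orbit_eq f T (y, u) (z, v)" (is "?L \<longleftrightarrow> ?R")
    if z: "z \<in> topspace X" for z v
  proof
    assume ?L
    then obtain x' s' where 1: "x' \<in> topspace X" "suspension_orbit_eq f T (x, s) (x', s')"
      "suspension_orbit_eq f T (x', s' + t) (z, v)"
      by (auto simp: suspension_rel_iff suspension_domain_def)
    have "suspension_orbit_eq f T (x, s + t) (z, v)"
      using orbit_eq_trans[OF xt 1(1) z orbit_eq_shift[OF 1(2)] 1(3)] .
    then show ?R using orbit_eq_trans[OF yt xt z orbit_eq_sym[OF eq]] by blast
  next
    assume ?R
    then have "suspension_orbit_eq f T (x, s + t) (z, v)"
      using orbit_eq_trans[OF xt yt z eq] by blast
    then show ?L using xs by (auto simp: suspension_rel_iff orbit_eq_refl intro!: bexI[of _ "(x, s)"])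
  qed
  note * = this
  show ?thesis
  proof (intro set_eqI)
    fix q :: "'a \<times> real"
    obtain z v where q: "q = (z, v)" by fastforce
    show "q \<in> suspension_flow X f T t (suspension_rel X f T `` {(x, s)}) \<longleftrightarrow>
        q \<in> suspension_rel X f T `` {(y, u)}"
      using *[of z v] yu
      by (simp add: q suspension_flow_def suspension_rel_iff[of "(y, u)"])
         (auto simp: suspension_domain_def)
  qed
qed

lemma suspension_flow_closed:
  assumes "P \<in> suspension_domain X T // suspension_rel X f T"
  shows "suspension_flow X f T t P \<in> suspension_domain X T // suspension_rel X f T"
proof -
  obtain x s where P: "P = suspension_rel X f T `` {(x, s)}" "(x, s) \<in> suspension_domain X T"
    using assms by (auto elim!: quotientE)
  then obtain y u where "(y, u) \<in> suspension_domain X T" "suspension_orbit_eq f T (x, s + t) (y, u)"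
    using orbit_eq_domain_exists[of x "s + t"] by (auto simp: suspension_domain_def)
  then show ?thesis using suspension_flow_class P by (auto intro: quotientI)
qed

lemma suspension_flow_vertical:
  assumes "(x, s) \<in> suspension_domain X T" "(x, s + t) \<in> suspension_domain X T"
  shows "suspension_flow X f T t (suspension_rel X f T `` {(x, s)}) =
    suspension_rel X f T `` {(x, s + t)}"
  using suspension_flow_class[OF assms orbit_eq_refl] .

lemma suspension_flow_0:
  assumes "P \<in> suspension_domain X T // suspension_rel X f T"
  shows "suspension_flow X f T 0 P = P"
  using assms suspension_flow_vertical[of _ _ 0] by (auto elim!: quotientE)

lemma suspension_flow_add:
  assumes "P \<in> suspension_domain X T // suspension_rel X f T"
  shows "suspension_flow X f T (t + t') P = suspension_flow X f T t (suspension_flow X f T t' P)"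
proof -
  obtain x s where P: "P = suspension_rel X f T `` {(x, s)}" "(x, s) \<in> suspension_domain X T"
    using assms by (auto elim!: quotientE)
  then have x: "x \<in> topspace X" by (auto simp: suspension_domain_def)
  obtain y u where y: "(y, u) \<in> suspension_domain X T" "suspension_orbit_eq f T (x, s + t') (y, u)"
    using orbit_eq_domain_exists[OF x] by (metis surj_pair)
  then have yt: "y \<in> topspace X" by (auto simp: suspension_domain_def)
  obtain z v where z: "(z, v) \<in> suspension_domain X T" "suspension_orbit_eq f T (y, u + t) (z, v)"
    using orbit_eq_domain_exists[OF yt] by (metis surj_pair)
  then have zt: "z \<in> topspace X" by (auto simp: suspension_domain_def)
  have "suspension_orbit_eq f T (x, s + (t + t')) (z, v)"
    using orbit_eq_trans[OF x yt zt orbit_eq_shift[OF y(2)] z(2)] by (simp add: algebra_simps)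
  then show ?thesis
    using suspension_flow_class P y z by simp
qed

end

lemma suspension_circle:
  assumes "\<And>z. z \<in> sphere 0 1 \<Longrightarrow> 0 < T z" and "continuous_on (sphere 0 1) T"
  shows "suspension circle (circle_rotation \<alpha>) T"
proof
  show "bij_betw (circle_rotation \<alpha>) (topspace circle) (topspace circle)"
    by (rule bij_betw_byWitness[where f' = "circle_rotation (- \<alpha>)"])
      (auto simp: circle_rotation_def norm_mult mult.assoc[symmetric] cis_mult)
  obtain w where "w \<in> sphere (0::complex) 1" "\<And>z. z \<in> sphere 0 1 \<Longrightarrow> T w \<le> T z"
    using continuous_attains_inf[of "sphere (0::complex) 1" T] assms(2)
    by (metis compact_sphere empty_iff mem_sphere_0 norm_one)
  then show "\<exists>c>0. \<forall>z\<in>topspace circle. c \<le> T z"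
    using assms(1) by (intro exI[of _ "T w"]) auto
qed

lemma continuous_on_circle:
  assumes "continuous_on UNIV (\<lambda>\<theta>. T (cis \<theta>))"
  shows "continuous_on (sphere 0 1) (T :: complex \<Rightarrow> real)"
proof -
  have cis: "continuous_on UNIV cis" by (intro continuous_intros)
  have img: "cis ` {0..2*pi} = sphere 0 1"
  proof (intro set_eqI iffI)
    fix z :: complex assume "z \<in> sphere 0 1"
    then have "z = cis (Arg2pi z)"
      using complex_norm_eq_1_exp[of z] by (simp add: cis_conv_exp)
    then show "z \<in> cis ` {0..2*pi}"
      using Arg2pi_ge_0[of z] Arg2pi_lt_2pi[of z] by (metis atLeastAtMost_iff image_eqI less_imp_le)
  qed auto
  have "quotient_map (top_of_set {0..2*pi}) circle cis"
  proof (rule T1_Spaces.continuous_imp_quotient_map)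
    show "continuous_map (top_of_set {0..2*pi}) circle cis"
      using img by (auto simp: intro!: continuous_intros)
  qed (auto simp: img compact_space_subtopology Hausdorff_space_subtopology)
  moreover have "continuous_map (top_of_set {0..2*pi}) euclideanreal (T \<circ> cis)"
    using continuous_on_subset[OF assms] by (simp add: comp_def)
  ultimately have "continuous_map circle euclideanreal T"
    using continuous_compose_quotient_map by blast
  then show ?thesis by simp
qed

lemma suspension_circle_compact_metrizable:
  fixes T :: "complex \<Rightarrow> real" and \<alpha> :: real
  assumes pos: "\<And>z. z \<in> sphere 0 1 \<Longrightarrow> 0 < T z" and cont: "continuous_on (sphere 0 1) T"
  defines "Y \<equiv> suspension_topology circle (circle_rotation \<alpha>) T"
  shows "compact_space Y" "metrizable_space Y"
proof -
  interpret suspension circle "circle_rotation \<alpha>" T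
    using suspension_circle assms by blast
  let ?D = "suspension_domain circle T" and ?r = "suspension_rel circle (circle_rotation \<alpha>) T"
  let ?DT = "subtopology (prod_topology circle euclideanreal) ?D"
  have "prod_topology circle euclideanreal = top_of_set (sphere 0 1 \<times> UNIV)"
    by (metis prod_topology_euclidean subtopology_Times subtopology_UNIV)
  moreover have "(sphere 0 1 \<times> UNIV) \<inter> ?D = ?D" by (auto simp: suspension_domain_def)
  ultimately have D0: "?DT = top_of_set ?D" by (simp add: subtopology_subtopology)
  have top: "topspace ?DT = ?D" by (simp add: D0)
  have Y: "quotient_map ?DT Y (\<lambda>x. ?r `` {x})"
    unfolding Y_def suspension_topology_def by (rule quotient_map_quotient_topology)
  have "?D = (\<lambda>(z, t). (z, t * T z)) ` (sphere 0 1 \<times> {0..1})" (is "_ = ?h ` _")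
  proof (intro set_eqI iffI)
    fix p assume "p \<in> ?D"
    then show "p \<in> ?h ` (sphere 0 1 \<times> {0..1})"
      using pos[of "fst p"]
      by (intro image_eqI[of _ _ "(fst p, snd p / T (fst p))"])
        (auto simp: suspension_domain_def field_simps)
  next
    fix p assume "p \<in> ?h ` (sphere 0 1 \<times> {0..1})"
    then show "p \<in> ?D"
      using pos by (force simp: suspension_domain_def intro: mult_left_le_one_le less_imp_le)
  qed
  moreover have contT: "continuous_on S (\<lambda>p. T (fst p))" if "fst ` S \<subseteq> sphere 0 1"
    for S :: "(complex \<times> real) set"
    using continuous_on_compose2[OF cont continuous_on_fst[OF continuous_on_id] that] .
  have "continuous_on (sphere 0 1 \<times> {0..1}) ?h"
    unfolding case_prod_beta by (intro continuous_intros contT) auto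
  then have "compact (?h ` (sphere 0 1 \<times> {0..1}))"
    by (intro compact_continuous_image compact_Times) auto
  ultimately have "compact ?D" by simp
  then have "compact_space ?DT" by (simp add: D0 compact_space_subtopology)
  then show cY: "compact_space Y"
    using image_compactin[of ?DT "topspace ?DT" Y] quotient_imp_continuous_map[OF Y]
      quotient_imp_surjective_map[OF Y] unfolding compact_space_def by metis
  define g :: "complex \<times> real \<Rightarrow> complex \<times> complex" where
    "g = (\<lambda>(z, t). (cis (2 * pi * (t / T z)), z * cis (2 * pi * \<alpha> * (t / T z))))"
  have TD: "T (fst p) \<noteq> 0" if "p \<in> ?D" for p
    using that pos[of "fst p"] by (auto simp: suspension_domain_def)
  have g_cont: "continuous_map ?DT euclidean g"
    unfolding D0 g_def case_prod_beta continuous_map_iff_continuous2 continuous_map_iff_continuous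
    by (intro continuous_intros contT ballI TD) (auto simp: suspension_domain_def)
  have g_glue: "g (z, T z) = g (circle_rotation \<alpha> z, 0)" if "z \<in> sphere 0 1" for z
  proof -
    have "cis (pi * 2) = 1" by (metis cis_2pi mult.commute)
    then show ?thesis using pos[OF that] by (simp add: g_def circle_rotation_def mult.commute)
  qed
  have rel_cases: "p = q \<or> (\<exists>z\<in>sphere 0 1. p = (z, T z) \<and> q = (circle_rotation \<alpha> z, 0))
      \<or> (\<exists>z\<in>sphere 0 1. q = (z, T z) \<and> p = (circle_rotation \<alpha> z, 0))"
    if "(p, q) \<in> ?r" for p q
  proof -
    obtain x s y u where pq: "p = (x, s)" "q = (y, u)" by fastforce
    have D: "(x, s) \<in> ?D" "(y, u) \<in> ?D" and xy: "x \<in> sphere 0 1" "y \<in> sphere 0 1"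
      using that by (auto simp: pq suspension_rel_iff suspension_domain_def)
    have "suspension_orbit_eq (circle_rotation \<alpha>) T (x, s) (y, u)"
      using that unfolding pq suspension_rel_iff by blast
    then obtain n where "(circle_rotation \<alpha> ^^ n) x = y \<and> s = birkhoff_sum (circle_rotation \<alpha>) T n x + u \<or>
        (circle_rotation \<alpha> ^^ n) y = x \<and> u = birkhoff_sum (circle_rotation \<alpha>) T n y + s"
      unfolding suspension_orbit_eq_def prod.case by blast
    then have "((x, s) = (y, u) \<or> s = T x \<and> (y, u) = (circle_rotation \<alpha> x, 0)) \<or>
        ((y, u) = (x, s) \<or> u = T y \<and> (x, s) = (circle_rotation \<alpha> y, 0))"
      using orbit_eq_domain[of x s y u n] orbit_eq_domain[of y u x s n] D by blast
    then show ?thesis using xy by (auto simp: pq)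
  qed
  have g_rel: "g p = g q" if "(p, q) \<in> ?r" for p q
    using rel_cases[OF that] g_glue by auto
  have glue_rel: "((z, T z), (circle_rotation \<alpha> z, 0)) \<in> ?r" if "z \<in> sphere 0 1" for z
    using that glue_orbit_eq[of z] pos[OF that] pos[of "circle_rotation \<alpha> z"]
    by (auto simp: suspension_rel_iff suspension_domain_def circle_rotation_def norm_mult less_imp_le)
  have norm_form: "\<exists>q\<in>?D. (p, q) \<in> ?r \<and> snd q < T (fst q)" if p: "p \<in> ?D" for p
  proof (cases "snd p < T (fst p)")
    case True
    then show ?thesis using p orbit_eq_refl by (intro bexI[of _ p]) (auto simp: suspension_rel_iff)
  next
    case False
    then obtain z where z: "p = (z, T z)" "z \<in> sphere 0 1"
      using p that by (cases p) (auto simp: suspension_domain_def)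
    then show ?thesis using glue_rel[OF z(2)] pos[of "circle_rotation \<alpha> z"]
      by (intro bexI[of _ "(circle_rotation \<alpha> z, 0)"])
        (auto simp: suspension_rel_iff circle_rotation_def norm_mult)
  qed
  have g_inj0: "p = q" if pq: "p \<in> ?D" "q \<in> ?D" "snd p < T (fst p)" "snd q < T (fst q)" "g p = g q" for p q
  proof -
    obtain x s y u where p: "p = (x, s)" and q: "q = (y, u)" by fastforce
    have Tx: "0 < T x" "0 < T y" using pq pos by (auto simp: p q suspension_domain_def)
    have range: "0 \<le> s / T x" "s / T x < 1" "0 \<le> u / T y" "u / T y < 1"
      using pq Tx by (auto simp: p q suspension_domain_def)
    have "cis (2 * pi * (s / T x)) = cis (2 * pi * (u / T y))"
      using pq(5) by (simp add: g_def p q)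
    then obtain n :: int where "2 * pi * (s / T x) = 2 * pi * (u / T y) + 2 * pi * n"
      using sin_cos_eq_iff[of "2 * pi * (s / T x)" "2 * pi * (u / T y)"]
      by (auto simp: complex_eq_iff)
    then have "2 * pi * (s / T x) = 2 * pi * (u / T y + n)" by (simp only: distrib_left)
    then have n: "s / T x = u / T y + n" by (metis mult_cancel_left pi_neq_zero mult_eq_0_iff zero_neq_numeral)
    then have "\<bar>real_of_int n\<bar> < 1" using range by linarith
    then have "n = 0" by linarith
    with n have eq: "s / T x = u / T y" by simp
    moreover have "x * cis (2 * pi * \<alpha> * (s / T x)) = y * cis (2 * pi * \<alpha> * (u / T y))"
      using pq(5) by (simp add: g_def p q)
    ultimately have "x = y" by (metis cis_neq_zero mult_cancel_right)
    then show ?thesis using eq Tx by (simp add: p q)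
  qed
  have g_inj: "?r `` {p} = ?r `` {q}" if D: "p \<in> ?D" "q \<in> ?D" "g p = g q" for p q
  proof -
    obtain p' where p': "p' \<in> ?D" "(p, p') \<in> ?r" "snd p' < T (fst p')"
      using norm_form[OF D(1)] by blast
    obtain q' where q': "q' \<in> ?D" "(q, q') \<in> ?r" "snd q' < T (fst q')"
      using norm_form[OF D(2)] by blast
    have "g p' = g q'" using g_rel[OF p'(2)] g_rel[OF q'(2)] D(3) by simp
    then have "p' = q'" using g_inj0 p' q' by blast
    then show ?thesis
      using equiv_class_eq[OF equiv_suspension_rel p'(2)]
        equiv_class_eq[OF equiv_suspension_rel q'(2)] by simp
  qed
  have g_class: "g p = g q" if "p \<in> topspace ?DT" "q \<in> topspace ?DT" "?r `` {p} = ?r `` {q}" for p q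
    using g_rel[OF eq_equiv_class[OF that(3) equiv_suspension_rel]] that(2) unfolding top by simp
  obtain h where h: "continuous_map Y euclidean h" "\<And>p. p \<in> topspace ?DT \<Longrightarrow> h (?r `` {p}) = g p"
  proof (rule quotient_map_lift_exists[OF Y g_cont])
    show "g p = g q" if "p \<in> topspace ?DT" "q \<in> topspace ?DT" "?r `` {p} = ?r `` {q}" for p q
      using that by (rule g_class)
  next
    fix h :: "(complex \<times> real) set \<Rightarrow> complex \<times> complex"
    assume h: "continuous_map Y euclidean h" "\<And>p. p \<in> topspace ?DT \<Longrightarrow> h (?r `` {p}) = g p"
    show thesis
    proof (rule that[of h])
      show "h (?r `` {p}) = g p" if "p \<in> topspace ?DT" for p
        using that by (rule h(2))
    qed (rule h(1))
  qed
  have topY: "topspace Y = ?D // ?r"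
    unfolding Y_def suspension_topology_def topspace_quotient_topology top ..
  have "inj_on h (topspace Y)"
  proof (rule inj_onI)
    fix P Q assume PQ: "P \<in> topspace Y" "Q \<in> topspace Y" "h P = h Q"
    obtain p where p: "P = ?r `` {p}" "p \<in> ?D" using PQ(1) unfolding topY by (rule quotientE)
    obtain q where q: "Q = ?r `` {q}" "q \<in> ?D" using PQ(2) unfolding topY by (rule quotientE)
    have "g p = g q" using PQ(3) h(2)[unfolded top, OF p(2)] h(2)[unfolded top, OF q(2)] p q by simp
    then show "P = Q" using g_inj[OF p(2) q(2)] p q by simp
  qed
  then have "embedding_map Y euclidean h"
    using continuous_imp_embedding_map[OF h(1) cY Hausdorff_space_euclidean] by blast
  then show "metrizable_space Y"
    using homeomorphic_metrizable_space[OF embedding_map_imp_homeomorphic_space]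
      metrizable_space_subtopology[OF metrizable_space_euclidean] by blast
qed

end

theory Submission
  imports Defs
begin

text \<open>
  For a good rational approximation \<open>p / q\<close> of \<open>\<alpha>\<close> the Birkhoff sum \<open>S\<^sub>q T\<close> over the rotation is
  almost constant: Denjoy and Koksma bound its oscillation by a multiple of the Lipschitz constant of
  \<open>T\<close>, and the bound tends to \<open>0\<close> because a \<open>C\<^sup>1\<close> function is cohomologous to functions with arbitrarily
  small derivative, namely its own averages along the rotation. Since the \<open>q\<close>-th iterate of the
  rotation is also close to the identity, flowing for the time \<open>S\<^sub>q T\<close> brings every point of the
  suspension back near itself. Hence a point and its image under this time map stay close forever,
  although they are far apart in time on a non-periodic orbit.
\<close>

subsection \<open>Birkhoff sums of periodic functions over an irrational translation\<close>

lemma periodic_add_int: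
  fixes h :: "real \<Rightarrow> 'a"
  assumes "\<And>x. h (x + 1) = h x"
  shows "h (x + of_int n) = h x"
proof -
  interpret periodic_fun_simple' h by standard (rule assms)
  show ?thesis by (rule plus_of_int)
qed

text \<open>An integer shift brings \<open>x\<close> into the unit interval; a point at distance
  less than \<open>1\<close> then lies in \<open>{-1..2}\<close>, where compactness applies. This is
  why the radius is \<open>min r 1\<close>.\<close>

lemma periodic_uniformly_continuous:
  fixes h :: "real \<Rightarrow> real"
  assumes per: "\<And>x. h (x + 1) = h x" and cont: "continuous_on UNIV h"
  shows "uniformly_continuous_on UNIV h"
  unfolding uniformly_continuous_on_def
proof (intro allI impI)
  fix e :: real assume "e > 0"
  have "uniformly_continuous_on {-1..2} h"
    by (intro compact_uniformly_continuous continuous_on_subset[OF cont]) auto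
  then obtain r where r: "r > 0"
    "\<And>x y. \<lbrakk>x \<in> {-1..2}; y \<in> {-1..2}; dist y x < r\<rbrakk> \<Longrightarrow> dist (h y) (h x) < e"
    unfolding uniformly_continuous_on_def using \<open>e > 0\<close> by blast
  have "dist (h y) (h x) < e" if "dist y x < min r 1" for x y
  proof -
    have "dist (h (y + of_int (- \<lfloor>x\<rfloor>))) (h (x + of_int (- \<lfloor>x\<rfloor>))) < e"
      using that by (intro r(2); simp add: dist_real_def) linarith+
    then show ?thesis unfolding periodic_add_int[of h, OF per] .
  qed
  then show "\<exists>d>0. \<forall>x\<in>UNIV. \<forall>x'\<in>UNIV. dist x' x < d \<longrightarrow> dist (h x') (h x) < e"
    using r(1) by (intro exI[of _ "min r 1"]) auto
qed

text \<open>This puts uniform continuity at the scale \<open>1 / q\<close> of the grids below, with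
  one threshold \<open>N\<close> for all larger denominators.\<close>

lemma periodic_uniformly_continuous_mesh:
  fixes h :: "real \<Rightarrow> real"
  assumes "\<And>x. h (x + 1) = h x" "continuous_on UNIV h" "\<eta> > 0"
  obtains N :: nat where "\<And>q u v. \<lbrakk>N \<le> q; \<bar>u - v\<bar> \<le> 1 / real q\<rbrakk> \<Longrightarrow> \<bar>h u - h v\<bar> \<le> \<eta>"
proof -
  obtain r where r: "r > 0" "\<And>u v. \<bar>u - v\<bar> < r \<Longrightarrow> \<bar>h u - h v\<bar> < \<eta>"
    using periodic_uniformly_continuous[OF assms(1,2)] assms(3)
    unfolding uniformly_continuous_on_def dist_real_def by (metis UNIV_I)
  obtain N :: nat where N: "1 / r < real N" using reals_Archimedean2 by blast
  show thesis
  proof (rule that[of N])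
    fix q :: nat and u v :: real assume q: "N \<le> q" "\<bar>u - v\<bar> \<le> 1 / real q"
    have "1 / r < real q" using N q(1) by linarith
    moreover from this have "0 < real q" using r(1) by (smt (verit) divide_pos_pos)
    ultimately have "1 / real q < r" using r(1) by (simp add: field_simps)
    then show "\<bar>h u - h v\<bar> \<le> \<eta>" using r(2)[of u v] q(2) by linarith
  qed
qed

lemma abs_sum_lessThan_le:
  fixes f :: "nat \<Rightarrow> real"
  assumes "\<And>j. j < n \<Longrightarrow> \<bar>f j\<bar> \<le> b"
  shows "\<bar>\<Sum>j<n. f j\<bar> \<le> real n * b"
  using sum_norm_bound[of "{..<n}" f b] assms by simp

section \<open>Birkhoff sums against Riemann sums at good denominators\<close>

text \<open>Multiplication by \<open>p\<close> permutes the residues modulo \<open>q\<close>, and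
  periodicity absorbs the integer quotients.\<close>

lemma sum_coprime_multiples:
  fixes h :: "real \<Rightarrow> real" and p :: int and q :: nat
  assumes per: "\<And>x. h (x + 1) = h x" and cop: "coprime p (int q)" and q: "q > 0"
  shows "(\<Sum>j<q. h (x + real j * (of_int p / real q))) = (\<Sum>j<q. h (x + real j / real q))"
proof -
  define s where "s = (\<lambda>j. nat ((int j * p) mod int q))"
  have s_int: "int (s j) = (int j * p) mod int q" for j
    using q by (simp add: s_def)
  have s_img: "s ` {..<q} \<subseteq> {..<q}"
    using q by (auto simp: s_def nat_less_iff)
  have "inj_on s {..<q}"
  proof (rule inj_onI)
    fix i j assume ij: "i \<in> {..<q}" "j \<in> {..<q}" "s i = s j"
    then have "int q dvd (int i - int j) * p"
      unfolding left_diff_distrib mod_eq_dvd_iff[symmetric] s_int[symmetric] by simp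
    then have "int q dvd int i - int j"
      using cop by (simp add: coprime_commute coprime_dvd_mult_left_iff)
    then have "int i mod int q = int j mod int q" by (simp add: mod_eq_dvd_iff)
    then show "i = j" using ij by simp
  qed
  then have bij: "bij_betw s {..<q} {..<q}"
    using s_img by (simp add: bij_betw_def endo_inj_surj)
  have "h (x + real j * (of_int p / real q)) = h (x + real (s j) / real q)" for j
  proof -
    have "int j * p = int (s j) + int q * ((int j * p) div int q)"
      by (simp add: s_int)
    then have "real j * of_int p = real (s j) + real q * of_int ((int j * p) div int q)"
      by (metis (no_types, lifting) of_int_add of_int_mult of_int_of_nat_eq)
    then have "x + real j * (of_int p / real q)
        = x + real (s j) / real q + of_int ((int j * p) div int q)"
      using q by (simp add: field_simps)
    then show ?thesis by (simp only: periodic_add_int[of h, OF per])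
  qed
  then have "(\<Sum>j<q. h (x + real j * (of_int p / real q))) = (\<Sum>j<q. h (x + real (s j) / real q))"
    by simp
  also have "\<dots> = (\<Sum>j<q. h (x + real j / real q))"
    by (rule sum.reindex_bij_betw[OF bij])
  finally show ?thesis .
qed

text \<open>During the first \<open>q\<close> steps the error of the approximation accumulates to at
  most \<open>q / q^2 = 1 / q\<close>, so each orbit point stays within one mesh width of its
  rational counterpart. The rational orbit is the grid in another order.\<close>

lemma birkhoff_near_riemann:
  fixes h :: "real \<Rightarrow> real" and p :: int and q :: nat
  assumes per: "\<And>x. h (x + 1) = h x" and cop: "coprime p (int q)" and q: "q > 0"
    and approx: "\<bar>\<alpha> - of_int p / real q\<bar> < 1 / (real q)\<^sup>2"
    and osc: "\<And>u v. \<bar>u - v\<bar> \<le> 1 / real q \<Longrightarrow> \<bar>h u - h v\<bar> \<le> \<eta>"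
  shows "\<bar>(\<Sum>j<q. h (x + real j * \<alpha>)) - (\<Sum>j<q. h (x + real j / real q))\<bar> \<le> real q * \<eta>"
proof -
  have "\<bar>h (x + real j * \<alpha>) - h (x + real j * (of_int p / real q))\<bar> \<le> \<eta>" if "j < q" for j
  proof (rule osc)
    have "real j * \<bar>\<alpha> - of_int p / real q\<bar> \<le> real q * (1 / (real q)\<^sup>2)"
      using that approx by (intro mult_mono) auto
    also have "\<dots> = 1 / real q" using q by (simp add: power2_eq_square)
    finally show "\<bar>x + real j * \<alpha> - (x + real j * (of_int p / real q))\<bar> \<le> 1 / real q"
      by (simp only: add_diff_add diff_self add_0 abs_mult abs_of_nat flip: right_diff_distrib)
  qed
  then have "\<bar>\<Sum>j<q. h (x + real j * \<alpha>) - h (x + real j * (of_int p / real q))\<bar> \<le> real q * \<eta>"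
    by (rule abs_sum_lessThan_le)
  then show ?thesis
    unfolding sum_subtractf sum_coprime_multiples[of h, OF per cop q] .
qed

text \<open>The difference telescopes to the two end values, which agree by periodicity.\<close>

lemma riemann_sum_shift:
  fixes h :: "real \<Rightarrow> real" and q :: nat
  assumes per: "\<And>x. h (x + 1) = h x" and q: "q > 0"
  shows "(\<Sum>j<q. h (x + 1 / real q + real j / real q)) = (\<Sum>j<q. h (x + real j / real q))"
proof -
  have "(\<Sum>j<q. h (x + real (Suc j) / real q) - h (x + real j / real q)) = 0"
    using sum_lessThan_telescope[of "\<lambda>j. h (x + real j / real q)" q] per[of x] q by simp
  then have "(\<Sum>j<q. h (x + real (Suc j) / real q)) = (\<Sum>j<q. h (x + real j / real q))"
    by (simp only: sum_subtractf)
  moreover have "x + 1 / real q + real j / real q = x + real (Suc j) / real q" for j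
    by (simp add: add_divide_distrib)
  ultimately show ?thesis by (simp only:)
qed

text \<open>The Riemann sum has period \<open>1 / q\<close> in its base point, so \<open>y\<close>
  may be replaced by a point \<open>y'\<close> within \<open>1 / q\<close> of \<open>x\<close>, and
  the sums compared term by term.\<close>

lemma riemann_sum_oscillation:
  fixes h :: "real \<Rightarrow> real" and q :: nat
  assumes per: "\<And>x. h (x + 1) = h x" and q: "q > 0"
    and osc: "\<And>u v. \<bar>u - v\<bar> \<le> 1 / real q \<Longrightarrow> \<bar>h u - h v\<bar> \<le> \<eta>"
  shows "\<bar>(\<Sum>j<q. h (x + real j / real q)) - (\<Sum>j<q. h (y + real j / real q))\<bar> \<le> real q * \<eta>"
proof -
  define G where "G = (\<lambda>x. \<Sum>j<q. h (x + real j / real q))"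
  define n where "n = \<lfloor>(x - y) * real q\<rfloor>"
  define y' where "y' = y + of_int n / real q"
  \<comment> \<open>Rescaling turns the period \<open>1 / q\<close> of \<open>G\<close> into the
    period \<open>1\<close> that \<open>periodic_add_int\<close> expects.\<close>
  have "(\<lambda>t. G (t / real q)) (t + 1) = (\<lambda>t. G (t / real q)) t" for t
    using riemann_sum_shift[of h q "t / real q", OF per q] by (simp add: G_def add_divide_distrib)
  from periodic_add_int[of "\<lambda>t. G (t / real q)", OF this, of "y * real q" n]
  have "G y' = G y" using q by (simp add: y'_def add_divide_distrib)
  moreover have "\<bar>G x - G y'\<bar> \<le> real q * \<eta>"
  proof -
    have "\<bar>(x - y) * real q - of_int n\<bar> \<le> 1" unfolding n_def by linarith
    then have "\<bar>(x - y') * real q\<bar> \<le> 1" using q by (simp add: y'_def algebra_simps)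
    then have "\<bar>x - y'\<bar> \<le> 1 / real q" using q by (simp only: abs_mult) (simp add: field_simps)
    then show ?thesis
      unfolding G_def sum_subtractf[symmetric] by (intro abs_sum_lessThan_le osc) simp
  qed
  ultimately show ?thesis by (simp add: G_def)
qed

text \<open>A Denjoy-Koksma inequality: one error \<open>q * \<eta>\<close> for each passage to a
  Riemann sum and one between the two Riemann sums. For a Lipschitz function \<open>\<eta>\<close>
  is of order \<open>1 / q\<close>, and the bound does not depend on \<open>q\<close>.\<close>

lemma birkhoff_oscillation:
  fixes h :: "real \<Rightarrow> real" and p :: int and q :: nat
  assumes per: "\<And>x. h (x + 1) = h x" and cop: "coprime p (int q)" and q: "q > 0"
    and approx: "\<bar>\<alpha> - of_int p / real q\<bar> < 1 / (real q)\<^sup>2"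
    and osc: "\<And>u v. \<bar>u - v\<bar> \<le> 1 / real q \<Longrightarrow> \<bar>h u - h v\<bar> \<le> \<eta>"
  shows "\<bar>(\<Sum>j<q. h (x + real j * \<alpha>)) - (\<Sum>j<q. h (y + real j * \<alpha>))\<bar> \<le> 3 * (real q * \<eta>)"
  using birkhoff_near_riemann[of h, OF assms, of x] birkhoff_near_riemann[of h, OF assms, of y]
    riemann_sum_oscillation[of h, OF per q osc, of x y]
  by linarith

text \<open>By the mean value theorem \<open>g'\<close> at a node is within \<open>\<eta>\<close> of
  \<open>q\<close> times the increment of \<open>g\<close> over the cell, and the increments around
  a full period cancel. This reflects that \<open>g'\<close> has integral \<open>0\<close>.\<close>

lemma riemann_sum_deriv:
  fixes g g' :: "real \<Rightarrow> real" and q :: nat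
  assumes per: "\<And>x. g (x + 1) = g x" and q: "q > 0"
    and deriv: "\<And>x. (g has_real_derivative g' x) (at x)"
    and osc: "\<And>u v. \<bar>u - v\<bar> \<le> 1 / real q \<Longrightarrow> \<bar>g' u - g' v\<bar> \<le> \<eta>"
  shows "\<bar>\<Sum>j<q. g' (x + real j / real q)\<bar> \<le> real q * \<eta>"
proof -
  let ?D = "\<lambda>j. g (x + real (Suc j) / real q) - g (x + real j / real q)"
  have "\<bar>g' (x + real j / real q) - real q * ?D j\<bar> \<le> \<eta>" for j
  proof -
    have "x + real j / real q < x + real (Suc j) / real q" using q by (simp add: field_simps)
    from MVT2[OF this, of g g'] deriv obtain z where z: "x + real j / real q < z"
      "z < x + real (Suc j) / real q"
      "?D j = (x + real (Suc j) / real q - (x + real j / real q)) * g' z" by blast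
    have "x + real (Suc j) / real q - (x + real j / real q) = 1 / real q"
      by (simp add: add_divide_distrib)
    moreover from this have "\<bar>x + real j / real q - z\<bar> \<le> 1 / real q" using z by linarith
    ultimately show ?thesis using osc[of "x + real j / real q" z] z(3) q by simp
  qed
  then have "\<bar>\<Sum>j<q. g' (x + real j / real q) - real q * ?D j\<bar> \<le> real q * \<eta>"
    by (rule abs_sum_lessThan_le)
  moreover have "(\<Sum>j<q. real q * ?D j) = 0"
    unfolding sum_distrib_left[symmetric]
    using sum_lessThan_telescope[of "\<lambda>j. g (x + real j / real q)" q] per[of x] q by simp
  ultimately show ?thesis by (simp only: sum_subtractf)
qed

section \<open>Averaging along the rotation and decay of the oscillation\<close>

text \<open>Dirichlet approximation: for irrational \<open>\<alpha>\<close> there are infinitely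
  many such coprime pairs, with unbounded denominators.\<close>

lemma good_approximations:
  fixes \<alpha> :: real
  assumes "\<alpha> \<notin> \<rat>"
  obtains p :: int and q :: nat where "coprime p (int q)" "q > K" "q > 0"
    "\<bar>\<alpha> - of_int p / real q\<bar> < 1 / (real q)\<^sup>2"
proof -
  have "infinite (approx_set \<alpha>)" using assms rational_iff_finite_approx_set by blast
  then obtain h k where "(h, k) \<in> approx_set \<alpha>" "k > int K" using infinite_approx_set by metis
  then show thesis using that[of h "nat k"] by (auto simp: approx_set_def)
qed

text \<open>The function \<open>g\<close> is cohomologous to its average over \<open>N\<close> steps; for a good denominator
  \<open>N\<close> the latter has a tiny Lipschitz constant, since the averages of \<open>g'\<close> tend to \<open>0\<close>.\<close>
lemma birkhoff_cohomology:
  fixes g :: "real \<Rightarrow> real"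
  shows "(\<Sum>j<q::nat. \<Sum>k<N::nat. g (x + real j * \<alpha> + real k * \<alpha>)) =
    real N * (\<Sum>j<q. g (x + real j * \<alpha>)) +
    (\<Sum>k<N. (\<Sum>j<k. g (x + real q * \<alpha> + real j * \<alpha>)) - (\<Sum>j<k. g (x + real j * \<alpha>)))"
proof -
  let ?S = "\<lambda>n::nat. \<lambda>x. \<Sum>j<n. g (x + real j * \<alpha>)"
  have split: "?S (m + n) x = ?S m x + ?S n (x + real m * \<alpha>)" for m n :: nat
    by (induction n) (simp_all add: algebra_simps)
  \<comment> \<open>The sum of length \<open>q + k\<close> is split in both orders, after
    \<open>k\<close> and after \<open>q\<close> terms.\<close>
  have "?S q (x + real k * \<alpha>) = ?S q x + (?S k (x + real q * \<alpha>) - ?S k x)" for k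
    using split[of k q] split[of q k] by (simp add: add.commute)
  moreover have "(\<Sum>j<q. \<Sum>k<N. g (x + real j * \<alpha> + real k * \<alpha>)) = (\<Sum>k<N. ?S q (x + real k * \<alpha>))"
    by (subst sum.swap) (simp add: algebra_simps)
  ultimately show ?thesis by (simp add: sum.distrib)
qed

text \<open>Two good denominators are chosen in turn. The first, \<open>N\<close>, bounds the
  derivative of \<open>A\<close> by \<open>2 * N * \<eta>\<close>, so that Denjoy-Koksma bounds the
  oscillation of the sums of \<open>A\<close> by \<open>6 * N * \<eta>\<close> for every good
  \<open>q\<close>. The second, \<open>q\<close>, is so large against \<open>N\<close> that the
  coboundary term is small. Finally everything is divided by \<open>N\<close>.\<close>

theorem birkhoff_oscillation_tendsto_0:
  fixes g g' :: "real \<Rightarrow> real"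
  assumes irrational: "\<alpha> \<notin> \<rat>" and per: "\<And>x. g (x + 1) = g x"
    and deriv: "\<And>x. (g has_real_derivative g' x) (at x)" and cont: "continuous_on UNIV g'"
    and "e > 0"
  obtains p :: int and q :: nat where "q > 0" "\<bar>real q * \<alpha> - of_int p\<bar> < e"
    "\<And>x y. \<bar>(\<Sum>j<q. g (x + real j * \<alpha>)) - (\<Sum>j<q. g (y + real j * \<alpha>))\<bar> < e"
proof -
  have per': "g' (x + 1) = g' x" for x
  proof -
    have "((\<lambda>x. g (x + 1)) has_real_derivative g' (x + 1) * 1) (at x)"
      by (rule DERIV_chain'[OF _ deriv, of "\<lambda>x. x + 1"]) (auto intro!: derivative_eq_intros)
    then have "(g has_real_derivative g' (x + 1)) (at x)" by (simp add: per)
    then show ?thesis using deriv DERIV_unique by blast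
  qed
  obtain C where C: "C > 0" "\<And>x. \<bar>g' x\<bar> \<le> C"
  proof -
    have "compact (g' ` {0..1})"
      by (intro compact_continuous_image continuous_on_subset[OF cont]) auto
    then obtain C where "C > 0" and C: "\<And>x. x \<in> {0..1} \<Longrightarrow> \<bar>g' x\<bar> \<le> C"
      using compact_imp_bounded bounded_pos by (metis image_eqI real_norm_def)
    moreover have "\<bar>g' x\<bar> \<le> C" for x
    proof -
      have "x + of_int (- \<lfloor>x\<rfloor>) \<in> {0..1}" by simp linarith
      then show ?thesis using C periodic_add_int[of g', OF per'] by metis
    qed
    ultimately show thesis using that by blast
  qed
  have lipschitz: "\<bar>f u - f v\<bar> \<le> B * \<bar>u - v\<bar>"
    if "\<And>x. (f has_real_derivative f' x) (at x)" "\<And>x. \<bar>f' x\<bar> \<le> B" for f f' :: "real \<Rightarrow> real" and B u v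
    using field_differentiable_bound[of UNIV f f' B u v] that by auto
  \<comment> \<open>The term \<open>6 * \<eta>\<close> becomes \<open>3 * e / 8\<close>, which
    leaves room for the coboundary error below \<open>e / 4\<close>.\<close>
  define \<eta> where "\<eta> = e / 16"
  have "\<eta> > 0" using \<open>e > 0\<close> by (simp add: \<eta>_def)
  obtain N0 where N0: "\<And>q u v. \<lbrakk>N0 \<le> q; \<bar>u - v\<bar> \<le> 1 / real q\<rbrakk> \<Longrightarrow> \<bar>g' u - g' v\<bar> \<le> \<eta>"
    using periodic_uniformly_continuous_mesh[OF per' cont \<open>\<eta> > 0\<close>] by blast
  obtain a N where N: "coprime a (int N)" "N > N0" "N > 0"
      "\<bar>\<alpha> - of_int a / real N\<bar> < 1 / (real N)\<^sup>2"
    using good_approximations[OF irrational] by blast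
  have oscN: "\<bar>g' u - g' v\<bar> \<le> \<eta>" if "\<bar>u - v\<bar> \<le> 1 / real N" for u v
    using N0[of N u v] N(2) that by simp
  define A where "A = (\<lambda>x. \<Sum>k<N. g (x + real k * \<alpha>))"
  define A' where "A' = (\<lambda>x. \<Sum>k<N. g' (x + real k * \<alpha>))"
  have A_deriv: "(A has_real_derivative A' x) (at x)" for x
  proof -
    have "((\<lambda>x. g (x + real k * \<alpha>)) has_real_derivative g' (x + real k * \<alpha>) * 1) (at x)" for k
      by (rule DERIV_chain'[OF _ deriv, of "\<lambda>x. x + real k * \<alpha>"]) (auto intro!: derivative_eq_intros)
    then show ?thesis unfolding A_def A'_def by (intro DERIV_sum) simp
  qed
  \<comment> \<open>One error \<open>N * \<eta>\<close> comes from passing to the Riemann sum of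
    \<open>g'\<close>, the other from that sum being nearly \<open>0\<close>.\<close>
  have A'_small: "\<bar>A' x\<bar> \<le> real N * (2 * \<eta>)" for x
    using birkhoff_near_riemann[of g', OF per' N(1,3,4) oscN, of x]
      riemann_sum_deriv[of g N g', OF per N(3) deriv oscN, of x]
    unfolding A'_def by (simp add: algebra_simps)
  have A_per: "A (x + 1) = A x" for x
    using per[of "x + real k * \<alpha>" for k] unfolding A_def by (simp add: add.assoc add.commute)
  \<comment> \<open>The first summand yields \<open>1 / q < e\<close>, the second
    \<open>2 * N * C / q < e / 4\<close>.\<close>
  obtain K :: nat where K: "1 / e + 8 * real N * C / e < real K" using reals_Archimedean2 by blast
  obtain p q where q: "coprime p (int q)" "q > K" "q > 0"
      "\<bar>\<alpha> - of_int p / real q\<bar> < 1 / (real q)\<^sup>2"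
    using good_approximations[OF irrational] by blast
  have "\<bar>real q * \<alpha> - of_int p\<bar> = real q * \<bar>\<alpha> - of_int p / real q\<bar>"
    using q(3) by (simp add: abs_mult_pos' right_diff_distrib)
  also have "\<dots> < real q * (1 / (real q)\<^sup>2)" using q(3,4) by (intro mult_strict_left_mono) auto
  also have "\<dots> = 1 / real q" using q(3) by (simp add: power2_eq_square)
  finally have qp: "\<bar>real q * \<alpha> - of_int p\<bar> < 1 / real q" .
  have big: "1 + 8 * real N * C < e * real q"
  proof -
    have "(1 + 8 * real N * C) / e < real q" using K q(2) by (simp add: add_divide_distrib)
    then show ?thesis using \<open>e > 0\<close> by (simp add: field_simps)
  qed
  let ?S = "\<lambda>n x. \<Sum>j<n. g (x + real j * \<alpha>)"
  have A_sum: "\<bar>(\<Sum>j<q. A (x + real j * \<alpha>)) - (\<Sum>j<q. A (y + real j * \<alpha>))\<bar> \<le> 6 * real N * \<eta>" for x y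
  proof -
    have "\<bar>A u - A v\<bar> \<le> real N * (2 * \<eta>) / real q" if "\<bar>u - v\<bar> \<le> 1 / real q" for u v
    proof -
      have "\<bar>A u - A v\<bar> \<le> real N * (2 * \<eta>) * \<bar>u - v\<bar>" using lipschitz[OF A_deriv A'_small] .
      also have "\<dots> \<le> real N * (2 * \<eta>) * (1 / real q)"
        using that \<open>\<eta> > 0\<close> by (intro mult_left_mono) auto
      finally show ?thesis by simp
    qed
    from birkhoff_oscillation[of A, OF A_per q(1,3,4) this, of x y] q(3)
    show ?thesis by simp
  qed
  \<comment> \<open>Modulo the integer \<open>p\<close>, translation by \<open>q * \<alpha>\<close>
    moves points by less than \<open>1 / q\<close>, hence changes each value of \<open>g\<close> by
    at most \<open>C / q\<close>.\<close>
  have shift: "\<bar>\<Sum>k<N. ?S k (x + real q * \<alpha>) - ?S k x\<bar> \<le> real N * (real N * C / real q)" for x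
  proof -
    have "\<bar>?S k (x + real q * \<alpha>) - ?S k x\<bar> \<le> real N * C / real q" if "k < N" for k
    proof -
      have "\<bar>g (x + real q * \<alpha> + real j * \<alpha>) - g (x + real j * \<alpha>)\<bar> \<le> C / real q" for j
      proof -
        let ?u = "x + real q * \<alpha> + real j * \<alpha> + of_int (- p)"
        have "\<bar>g ?u - g (x + real j * \<alpha>)\<bar> \<le> C * \<bar>?u - (x + real j * \<alpha>)\<bar>"
          using lipschitz[OF deriv C(2)] .
        also have "\<dots> \<le> C * (1 / real q)" using qp C(1) by (intro mult_left_mono) auto
        finally show ?thesis by (simp only: periodic_add_int[of g, OF per]) simp
      qed
      then have "\<bar>?S k (x + real q * \<alpha>) - ?S k x\<bar> \<le> real k * (C / real q)"
        unfolding sum_subtractf[symmetric] by (rule abs_sum_lessThan_le)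
      also have "\<dots> \<le> real N * (C / real q)"
        using that C(1) by (intro mult_right_mono) auto
      finally show ?thesis by simp
    qed
    then show ?thesis by (rule abs_sum_lessThan_le)
  qed
  show thesis
  proof (rule that[of q p])
    show "q > 0" by (rule q(3))
    have "1 / real q < e" using big q(3) C(1) N(3)
      by (simp add: divide_less_eq) (smt (verit) mult_nonneg_nonneg of_nat_0_le_iff)
    then show "\<bar>real q * \<alpha> - of_int p\<bar> < e" using qp by linarith
  next
    fix x y
    let ?E = "\<lambda>x. \<Sum>k<N. ?S k (x + real q * \<alpha>) - ?S k x"
    have "real N * \<bar>?S q x - ?S q y\<bar> = \<bar>real N * ?S q x - real N * ?S q y\<bar>"
      by (simp add: abs_mult_pos' right_diff_distrib)
    also have "real N * ?S q x - real N * ?S q y =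
        ((\<Sum>j<q. A (x + real j * \<alpha>)) - (\<Sum>j<q. A (y + real j * \<alpha>))) - (?E x - ?E y)"
      unfolding A_def birkhoff_cohomology by simp
    also have "\<bar>\<dots>\<bar> \<le> 6 * real N * \<eta> + 2 * (real N * (real N * C / real q))"
      using A_sum[of x y] shift[of x] shift[of y] by linarith
    also have "\<dots> = real N * (6 * \<eta> + 2 * (real N * C / real q))" by (simp add: algebra_simps)
    finally have "\<bar>?S q x - ?S q y\<bar> \<le> 6 * \<eta> + 2 * (real N * C / real q)"
      using N(3) by simp
    moreover have "2 * (real N * C / real q) < e / 4"
      using big q(3) by (simp add: field_simps)
    ultimately show "\<bar>?S q x - ?S q y\<bar> < e" unfolding \<eta>_def using \<open>e > 0\<close> by linarith
  qed
qed

subsection \<open>Rigid suspensions\<close>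

text \<open>The pulled-back distance is uniformly continuous on \<open>D \<times> D\<close> and
  vanishes on the diagonal; \<open>(u, v)\<close> is compared with \<open>(u, u)\<close>. This
  reduces estimates in an arbitrary metric on the quotient to the product metric on the
  domain.\<close>

lemma (in Metric_space) compact_uniformly_continuous:
  fixes p :: "'b::metric_space \<Rightarrow> 'a"
  assumes p: "continuous_map (top_of_set D) mtopology p" and D: "compact D" and "e > 0"
  obtains r where "r > 0" "\<And>u v. \<lbrakk>u \<in> D; v \<in> D; dist u v < r\<rbrakk> \<Longrightarrow> d (p u) (p v) < e"
proof -
  let ?F = "\<lambda>w. mdist (metric (M, d)) (p (fst w)) (p (snd w))"
  have "continuous_map (top_of_set (D \<times> D)) mtopology (\<lambda>w. p (fst w))"
    by (rule continuous_map_compose[OF _ p, of _ fst, unfolded comp_def]) (auto intro: continuous_intros)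
  moreover have "continuous_map (top_of_set (D \<times> D)) mtopology (\<lambda>w. p (snd w))"
    by (rule continuous_map_compose[OF _ p, of _ snd, unfolded comp_def]) (auto intro: continuous_intros)
  ultimately have "continuous_map (top_of_set (D \<times> D)) euclideanreal ?F"
    by (intro continuous_map_mdist) (simp_all add: mtopology_of_def)
  then have "continuous_on (D \<times> D) ?F" by simp
  then have "uniformly_continuous_on (D \<times> D) ?F"
    by (rule compact_uniformly_continuous) (rule compact_Times[OF D D])
  then obtain r where r: "r > 0"
    "\<And>w w'. \<lbrakk>w \<in> D \<times> D; w' \<in> D \<times> D; dist w' w < r\<rbrakk> \<Longrightarrow> dist (?F w') (?F w) < e"
    unfolding uniformly_continuous_on_def using \<open>e > 0\<close> by blast
  show thesis
  proof (rule that[OF r(1)])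
    fix u v assume uv: "u \<in> D" "v \<in> D" "dist u v < r"
    have "p u \<in> M" using p uv(1) by (auto simp: continuous_map_def)
    moreover have "dist (?F (u, v)) (?F (u, u)) < e"
      using uv by (intro r(2)) (auto simp: dist_Pair_Pair dist_commute)
    ultimately show "d (p u) (p v) < e" by (simp add: dist_real_def)
  qed
qed

text \<open>Rescaling the fibres makes the domain a continuous image of
  \<open>L \<times> {0..1}\<close>.\<close>

lemma compact_suspension_domain:
  fixes L :: "'a::metric_space set"
  assumes "compact L" and T: "continuous_on L T" and pos: "\<And>x. x \<in> L \<Longrightarrow> 0 < T x"
  shows "compact (suspension_domain (top_of_set L) T)"
proof -
  let ?h = "\<lambda>p. (fst p, snd p * T (fst p))"
  have "suspension_domain (top_of_set L) T = ?h ` (L \<times> {0..1})"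
  proof (intro set_eqI iffI)
    fix p assume "p \<in> suspension_domain (top_of_set L) T"
    then show "p \<in> ?h ` (L \<times> {0..1})"
      using pos[of "fst p"]
      by (intro image_eqI[of _ _ "(fst p, snd p / T (fst p))"])
        (auto simp: suspension_domain_def field_simps)
  next
    fix p assume "p \<in> ?h ` (L \<times> {0..1})"
    then show "p \<in> suspension_domain (top_of_set L) T"
      using pos by (force simp: suspension_domain_def intro: mult_left_le_one_le less_imp_le)
  qed
  moreover have "continuous_on (L \<times> {0..1}) ?h"
    by (intro continuous_intros continuous_on_compose2[OF T]) auto
  ultimately show ?thesis
    using \<open>compact L\<close> by (simp add: compact_continuous_image compact_Times)
qed

text \<open>If time \<open>t\<close> fixes the class, then \<open>(x, s + t)\<close> and
  \<open>(x, s)\<close> are identified after some number \<open>n\<close> of roof crossings with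
  \<open>f^n x = x\<close>. Aperiodicity forces \<open>n = 0\<close>, and the empty Birkhoff sum
  gives \<open>t = 0\<close>.\<close>

lemma (in suspension) suspension_flow_fixed_point:
  assumes P: "P = suspension_rel X f T `` {(x, s)}" "(x, s) \<in> suspension_domain X T"
    and aper: "\<And>n. n > 0 \<Longrightarrow> (f ^^ n) x \<noteq> x" and fixed: "suspension_flow X f T t P = P"
  shows "t = 0"
proof -
  have x: "x \<in> topspace X" using P(2) by (simp add: suspension_domain_def)
  have "(x, s) \<in> P"
    unfolding P(1) Image_singleton_iff suspension_rel_iff using P(2) orbit_eq_refl by blast
  then have "(x, s) \<in> suspension_flow X f T t P" using fixed by simp
  then obtain y u where y: "(y, u) \<in> P" "suspension_orbit_eq f T (y, u + t) (x, s)"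
    by (auto simp: suspension_flow_def)
  then have "suspension_orbit_eq f T (x, s) (y, u)" and yt: "y \<in> topspace X"
    unfolding P(1) Image_singleton_iff suspension_rel_iff by (auto simp: suspension_domain_def)
  then have "suspension_orbit_eq f T (x, s + t) (x, s)"
    using orbit_eq_trans[OF x yt x orbit_eq_shift y(2)] by blast
  then obtain n where n: "(f ^^ n) x = x"
    "s + t = birkhoff_sum f T n x + s \<or> s = birkhoff_sum f T n x + (s + t)"
    unfolding suspension_orbit_eq_def prod.case by blast
  then have "n = 0" using aper by blast
  then show "t = 0" using n(2) by (simp add: birkhoff_sum_def)
qed

text \<open>If the base is rigid along iterates whose return times are almost constant, then some
  \<open>\<phi>\<^sub>\<tau>\<close> with \<open>\<tau>\<close> bounded away from \<open>0\<close> is uniformly close to the identity, so that a point and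
  its image under \<open>\<phi>\<^sub>\<tau>\<close> are never separated.\<close>
theorem not_kinematic_expansive_of_rigid:
  fixes L :: "'a::metric_space set" and f :: "'a \<Rightarrow> 'a" and T :: "'a \<Rightarrow> real"
  defines "Y \<equiv> suspension_topology (top_of_set L) f T"
  assumes susp: "suspension (top_of_set L) f T"
    and L: "compact L" and f: "continuous_on L f" and T: "continuous_on L T"
    and rigid: "\<And>e. e > 0 \<Longrightarrow> \<exists>q>0. (\<forall>x\<in>L. dist ((f ^^ q) x) x < e) \<and>
      (\<forall>x\<in>L. \<forall>y\<in>L. \<bar>birkhoff_sum f T q x - birkhoff_sum f T q y\<bar> < e)"
    and aperiodic: "x0 \<in> L" "\<And>n. n > 0 \<Longrightarrow> (f ^^ n) x0 \<noteq> x0"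
    and metric: "Metric_space (topspace Y) d"
    and metric_topology: "Metric_space.mtopology (topspace Y) d = Y"
  shows "\<not> kinematic_expansive (topspace Y) d (suspension_flow (top_of_set L) f T)"
proof
  interpret suspension "top_of_set L" f T by (rule susp)
  interpret Y: Metric_space "topspace Y" d by (rule metric)
  let ?X = "top_of_set L"
  let ?D = "suspension_domain ?X T" and ?r = "suspension_rel ?X f T"
  let ?p = "\<lambda>u. ?r `` {u}" and ?\<phi> = "suspension_flow ?X f T"
  let ?S = "birkhoff_sum f T"
  obtain c where c: "c > 0" "\<And>x. x \<in> L \<Longrightarrow> c \<le> T x" using bounded_below by auto
  have D_iff: "(x, s) \<in> ?D \<longleftrightarrow> x \<in> L \<and> 0 \<le> s \<and> s \<le> T x" for x s
    by (simp add: suspension_domain_def)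
  have top: "subtopology (prod_topology ?X euclideanreal) ?D = top_of_set ?D"
  proof -
    have "prod_topology ?X euclideanreal = top_of_set (L \<times> UNIV)"
      by (metis prod_topology_euclidean subtopology_Times subtopology_UNIV)
    moreover have "(L \<times> UNIV) \<inter> ?D = ?D" by (auto simp: suspension_domain_def)
    ultimately show ?thesis by (simp add: subtopology_subtopology)
  qed
  have topY: "topspace Y = ?D // ?r"
    by (simp add: Y_def suspension_topology_def top)
  have pY: "?p u \<in> topspace Y" if "u \<in> ?D" for u
    unfolding topY using that by (rule quotientI)
  have "quotient_map (top_of_set ?D) Y ?p"
    unfolding Y_def suspension_topology_def top by (rule quotient_map_quotient_topology)
  then have p_cont: "continuous_map (top_of_set ?D) Y.mtopology ?p"
    unfolding metric_topology by (rule quotient_imp_continuous_map)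
  have D_compact: "compact ?D"
    using compact_suspension_domain[OF L T] T_pos by simp
  have fL: "f x \<in> L" if "x \<in> L" for x using that bij bij_betwE by fastforce

  have almost_period: "\<exists>\<tau>\<ge>c. \<forall>z\<in>topspace Y. d z (?\<phi> \<tau> z) < \<delta>" if "\<delta> > 0" for \<delta>
  proof -
    \<comment> \<open>Half of \<open>\<delta>\<close>, since crossing the roof costs two such
      estimates.\<close>
    obtain r where r: "r > 0" "\<And>u v. \<lbrakk>u \<in> ?D; v \<in> ?D; dist u v < r\<rbrakk> \<Longrightarrow> d (?p u) (?p v) < \<delta> / 2"
      using Y.compact_uniformly_continuous[OF p_cont D_compact, of "\<delta> / 2"] \<open>\<delta> > 0\<close> by auto
    \<comment> \<open>Displacements in the domain will stay below \<open>4 * e \<le> r\<close>. The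
      height after a crossing is below \<open>3 * e < c\<close>, hence under the next roof.\<close>
    define e where "e = min (r / 4) (c / 4)"
    have e: "e > 0" "4 * e \<le> r" "4 * e \<le> c" using r(1) c(1) by (auto simp: e_def min_def)
    obtain e1 where e1: "e1 > 0" "\<And>x y. \<lbrakk>x \<in> L; y \<in> L; dist x y < e1\<rbrakk> \<Longrightarrow> \<bar>T x - T y\<bar> < e"
      using compact_uniformly_continuous[OF T L] e(1)
      unfolding uniformly_continuous_on_def dist_real_def by metis
    obtain e2 where e2: "e2 > 0" "\<And>x y. \<lbrakk>x \<in> L; y \<in> L; dist x y < e2\<rbrakk> \<Longrightarrow> dist (f x) (f y) < e"
      using compact_uniformly_continuous[OF f L] e(1)
      unfolding uniformly_continuous_on_def by metis
    obtain q where q: "q > 0" "\<And>x. x \<in> L \<Longrightarrow> dist ((f ^^ q) x) x < min e (min e1 e2)"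
      "\<And>x y. \<lbrakk>x \<in> L; y \<in> L\<rbrakk> \<Longrightarrow> \<bar>?S q x - ?S q y\<bar> < min e (min e1 e2)"
      using rigid[of "min e (min e1 e2)"] e(1) e1(1) e2(1) by auto
    \<comment> \<open>The summand \<open>e\<close> makes the flow overshoot the return, so that \<open>\<phi>\<^sub>\<tau>(z)\<close> lies above the base
      and at most one crossing of the roof has to be considered.\<close>
    define \<tau> where "\<tau> = ?S q x0 + e"
    have "c \<le> T x0" using c(2) aperiodic(1) .
    also have "\<dots> \<le> ?S q x0"
      using q(1) aperiodic(1) funpow_in T_pos member_le_sum[of 0 "{..<q}" "\<lambda>i. T ((f ^^ i) x0)"]
      by (simp add: birkhoff_sum_def less_imp_le)
    finally have "c \<le> \<tau>" using e(1) by (simp add: \<tau>_def)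
    moreover have "d z (?\<phi> \<tau> z) < \<delta>" if z: "z \<in> topspace Y" for z
    proof -
      obtain x s where xs: "z = ?p (x, s)" "(x, s) \<in> ?D"
        using z unfolding topY by (auto elim: quotientE)
      then have x: "x \<in> L" "0 \<le> s" "s \<le> T x" by (auto simp: D_iff)
      define y where "y = (f ^^ q) x"
      define \<rho> where "\<rho> = \<tau> - ?S q x"
      have y: "y \<in> L" using funpow_in[of x q] x(1) by (simp add: y_def)
      have xy: "dist x y < e" "dist x y < e1" "dist x y < e2"
        using q(2)[OF x(1)] by (auto simp: y_def dist_commute)
      have Txy: "\<bar>T x - T y\<bar> < e" using e1(2)[OF x(1) y xy(2)] .
      \<comment> \<open>The Birkhoff sums at \<open>x\<close> and \<open>x0\<close> differ by less
        than \<open>e\<close>, so \<open>\<rho>\<close> differs from the overshoot \<open>e\<close>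
        by less than \<open>e\<close>.\<close>
      have \<rho>: "0 < \<rho>" "\<rho> < 2 * e"
        using q(3)[OF x(1) aperiodic(1)] by (auto simp: \<rho>_def \<tau>_def)
      show ?thesis
      proof (cases "s + \<rho> \<le> T y")
        case True
        then have yD: "(y, s + \<rho>) \<in> ?D" using y x \<rho> by (simp add: D_iff)
        have "suspension_orbit_eq f T (x, s + \<tau>) (y, s + \<rho>)"
          by (auto simp: suspension_orbit_eq_def \<rho>_def y_def intro!: exI[of _ q])
        then have "?\<phi> \<tau> z = ?p (y, s + \<rho>)"
          using suspension_flow_class[OF xs(2) yD] xs(1) by simp
        moreover have "dist (x, s) (y, s + \<rho>) < r"
        proof -
          have "dist (x, s) (y, s + \<rho>) \<le> dist x y + \<rho>"
            using sqrt_sum_squares_le_sum[of "dist x y" \<rho>] \<rho> by (simp add: dist_Pair_Pair dist_real_def)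
          then show ?thesis using xy(1) \<rho>(2) e by linarith
        qed
        ultimately show ?thesis using r(2)[OF xs(2) yD] xs(1) \<open>\<delta> > 0\<close> by simp
      next
        case False
        define u where "u = s + \<rho> - T y"
        have u: "0 < u" "u < 3 * e" using False x(3) \<rho>(2) Txy by (auto simp: u_def)
        have roof: "(x, T x) \<in> ?D" "(f x, 0) \<in> ?D"
          using x(1) fL c by (auto simp: D_iff intro: order_trans[OF less_imp_le])
        have yD: "(f y, u) \<in> ?D" using fL[OF y] u e(3) c(2)[OF fL[OF y]] by (simp add: D_iff)
        \<comment> \<open>One crossing more than in the other case: the sum of length
          \<open>Suc q\<close> adds the return time \<open>T y\<close>.\<close>
        have "suspension_orbit_eq f T (x, s + \<tau>) (f y, u)"
          by (auto simp: suspension_orbit_eq_def \<rho>_def u_def y_def birkhoff_sum_def intro!: exI[of _ "Suc q"])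
        then have "?\<phi> \<tau> z = ?p (f y, u)"
          using suspension_flow_class[OF xs(2) yD] xs(1) by simp
        \<comment> \<open>The path from \<open>(x, s)\<close> climbs to the roof over
          \<open>x\<close>, passes through the gluing to \<open>(f x, 0)\<close>, and ends at
          \<open>(f y, u)\<close>.\<close>
        moreover have "?p (x, T x) = ?p (f x, 0)"
          using roof glue_orbit_eq
          by (intro equiv_class_eq[OF equiv_suspension_rel]) (simp add: suspension_rel_iff)
        moreover have "dist (x, s) (x, T x) < r"
          using False \<rho>(2) Txy x(3) e by (simp add: dist_Pair_Pair dist_real_def)
        moreover have "dist (f x, 0) (f y, u) < r"
        proof -
          have "dist (f x, 0) (f y, u) \<le> dist (f x) (f y) + u"
            using sqrt_sum_squares_le_sum[of "dist (f x) (f y)" u] u by (simp add: dist_Pair_Pair dist_real_def)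
          then show ?thesis using e2(2)[OF x(1) y xy(3)] u(2) e by linarith
        qed
        ultimately show ?thesis
          using Y.triangle[of "?p (x, s)" "?p (x, T x)" "?p (f y, u)"] pY xs roof yD
            r(2)[OF xs(2) roof(1)] r(2)[OF roof(2) yD] by simp
      qed
    qed
    ultimately show ?thesis by blast
  qed

  let ?z = "?p (x0, 0)"
  have z_dom: "(x0, 0) \<in> ?D" using aperiodic(1) c by (auto simp: D_iff intro: order_trans[OF less_imp_le])
  have z: "?z \<in> topspace Y" using pY[OF z_dom] .
  have closed: "?\<phi> t w \<in> topspace Y" if "w \<in> topspace Y" for t w
    using that suspension_flow_closed unfolding topY by blast
  have add: "?\<phi> (t + t') ?z = ?\<phi> t (?\<phi> t' ?z)" for t t'
    using suspension_flow_add z unfolding topY by blast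
  assume "kinematic_expansive (topspace Y) d ?\<phi>"
  \<comment> \<open>Expansiveness is tested at \<open>c\<close>, the lower bound for
    \<open>\<tau>\<close>, so that the time \<open>s\<close> it provides cannot equal
    \<open>\<tau>\<close>.\<close>
  then obtain \<delta> where "\<delta> > 0" and \<delta>: "\<And>x y. \<lbrakk>x \<in> topspace Y; y \<in> topspace Y;
      \<And>t. d (?\<phi> t x) (?\<phi> t y) < \<delta>\<rbrakk> \<Longrightarrow> \<exists>s. \<bar>s\<bar> < c \<and> y = ?\<phi> s x"
    unfolding kinematic_expansive_def using c(1) by meson
  obtain \<tau> where \<tau>: "\<tau> \<ge> c" "\<And>w. w \<in> topspace Y \<Longrightarrow> d w (?\<phi> \<tau> w) < \<delta>"
    using almost_period[OF \<open>\<delta> > 0\<close>] by blast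
  \<comment> \<open>Times \<open>t\<close> and \<open>\<tau>\<close> commute, so this is the
    almost-period estimate at the point \<open>?\<phi> t ?z\<close>.\<close>
  have "d (?\<phi> t ?z) (?\<phi> t (?\<phi> \<tau> ?z)) < \<delta>" for t
    using \<tau>(2)[OF closed[OF z, of t]] add[of t \<tau>] add[of \<tau> t] by (simp add: add.commute)
  then obtain s where s: "\<bar>s\<bar> < c" "?\<phi> \<tau> ?z = ?\<phi> s ?z"
    using \<delta>[OF z closed[OF z]] by blast
  have "?\<phi> (- s + \<tau>) ?z = ?\<phi> (- s + s) ?z" unfolding add s(2) ..
  also have "\<dots> = ?z" using suspension_flow_0 z unfolding topY by simp
  finally have "- s + \<tau> = 0"
    using suspension_flow_fixed_point[OF refl z_dom aperiodic(2)] by blast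
  then show False using s(1) \<tau>(1) by linarith
qed

subsection \<open>Irrational rotations\<close>

lemma circle_rotation_funpow: "(circle_rotation \<alpha> ^^ n) z = cis (2 * pi * (real n * \<alpha>)) * z"
proof (induction n)
  case (Suc n)
  have angle: "2 * pi * \<alpha> + 2 * pi * (real n * \<alpha>) = 2 * pi * (real (Suc n) * \<alpha>)"
    by (simp add: algebra_simps)
  have "(circle_rotation \<alpha> ^^ Suc n) z = circle_rotation \<alpha> ((circle_rotation \<alpha> ^^ n) z)" by simp
  also have "\<dots> = cis (2 * pi * \<alpha>) * cis (2 * pi * (real n * \<alpha>)) * z"
    unfolding Suc by (simp add: circle_rotation_def)
  finally show ?case unfolding cis_mult angle .
qed simp

text \<open>A return after \<open>n\<close> steps would make \<open>n * \<alpha>\<close> an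
  integer.\<close>

lemma circle_rotation_aperiodic:
  assumes "\<alpha> \<notin> \<rat>" "n > 0"
  shows "(circle_rotation \<alpha> ^^ n) 1 \<noteq> 1"
proof
  assume "(circle_rotation \<alpha> ^^ n) 1 = 1"
  then have "cos (2 * pi * (real n * \<alpha>)) = 1"
    by (simp add: circle_rotation_funpow complex_eq_iff)
  then obtain k :: int where "2 * pi * (real n * \<alpha>) = of_int k * (2 * pi)"
    unfolding cos_one_2pi_int by auto
  then have "real n * \<alpha> = of_int k" by simp
  then have "\<alpha> = of_int k / of_int (int n)" using \<open>n > 0\<close> by (simp add: field_simps)
  then have "\<alpha> \<in> \<rat>" by (metis Rats_divide Rats_of_int)
  then show False using assms(1) by simp
qed

text \<open>In the angle, measured in full turns, \<open>T\<close> becomes the \<open>C1\<close>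
  function \<open>g\<close> of period \<open>1\<close>. One \<open>q\<close> makes the oscillation
  of its sums small and puts \<open>q * \<alpha>\<close> near an integer; the latter brings the
  iterate near the identity.\<close>

lemma circle_rotation_rigid:
  fixes T :: "complex \<Rightarrow> real"
  assumes irrational: "\<alpha> \<notin> \<rat>" and C1: "(\<lambda>\<theta>. T (cis \<theta>)) C1_differentiable_on UNIV" and "e > 0"
  shows "\<exists>q>0. (\<forall>z\<in>sphere 0 1. dist ((circle_rotation \<alpha> ^^ q) z) z < e) \<and>
    (\<forall>z\<in>sphere 0 1. \<forall>w\<in>sphere 0 1.
      \<bar>birkhoff_sum (circle_rotation \<alpha>) T q z - birkhoff_sum (circle_rotation \<alpha>) T q w\<bar> < e)"
proof -
  obtain D where D: "\<And>\<theta>. ((\<lambda>\<theta>. T (cis \<theta>)) has_real_derivative D \<theta>) (at \<theta>)" "continuous_on UNIV D"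
    using C1 unfolding C1_differentiable_on_def has_real_derivative_iff_has_vector_derivative by auto
  define g where "g = (\<lambda>x. T (cis (2 * pi * x)))"
  have per: "g (x + 1) = g x" for x
    by (simp add: g_def distrib_left flip: cis_mult)
  have deriv: "(g has_real_derivative D (2 * pi * x) * (2 * pi)) (at x)" for x
    unfolding g_def
    by (rule DERIV_chain'[OF _ D(1), of "\<lambda>x. 2 * pi * x"]) (auto intro!: derivative_eq_intros)
  have cont: "continuous_on UNIV (\<lambda>x. D (2 * pi * x) * (2 * pi))"
    by (intro continuous_intros continuous_on_compose2[OF D(2)]) auto
  have sum: "birkhoff_sum (circle_rotation \<alpha>) T n (cis (2 * pi * x)) = (\<Sum>j<n. g (x + real j * \<alpha>))" for n x
    by (simp add: birkhoff_sum_def circle_rotation_funpow g_def cis_mult algebra_simps)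
  have circle: "\<exists>x. z = cis (2 * pi * x)" if "z \<in> sphere 0 1" for z
  proof -
    have "z = cis (Arg2pi z)"
      using that complex_norm_eq_1_exp[of z] by (simp add: cis_conv_exp)
    then show ?thesis by (intro exI[of _ "Arg2pi z / (2 * pi)"]) simp
  qed
  have "continuous_on UNIV cis" by (intro continuous_intros)
  then have "isCont cis 0" by (simp add: continuous_on_eq_continuous_at)
  then obtain r where r: "r > 0" "\<And>t. dist t 0 < r \<Longrightarrow> dist (cis t) (cis 0) < e"
    unfolding continuous_at_eps_delta using \<open>e > 0\<close> by blast
  \<comment> \<open>The second bound accounts for the factor \<open>2 * pi\<close> between turns and
    radians.\<close>
  define e' where "e' = min e (r / (2 * pi))"
  have "e' > 0" using \<open>e > 0\<close> r(1) by (simp add: e'_def)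
  obtain p :: int and q where q: "q > 0" "\<bar>real q * \<alpha> - of_int p\<bar> < e'"
    "\<And>x y. \<bar>(\<Sum>j<q. g (x + real j * \<alpha>)) - (\<Sum>j<q. g (y + real j * \<alpha>))\<bar> < e'"
    by (rule birkhoff_oscillation_tendsto_0[OF irrational per deriv cont \<open>e' > 0\<close>])
      (rule that)
  have "dist ((circle_rotation \<alpha> ^^ q) z) z < e" if "z \<in> sphere 0 1" for z
  proof -
    let ?t = "2 * pi * (real q * \<alpha> - of_int p)"
    have "2 * pi * (real q * \<alpha>) = ?t + 2 * pi * of_int p" by (simp add: algebra_simps)
    then have "cis (2 * pi * (real q * \<alpha>)) = cis ?t * cis (2 * pi * of_int p)"
      by (simp only: cis_mult)
    also have "\<dots> = cis ?t" by (simp add: cis_multiple_2pi)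
    finally have "(circle_rotation \<alpha> ^^ q) z - z = (cis ?t - 1) * z"
      unfolding circle_rotation_funpow left_diff_distrib by simp
    then have "dist ((circle_rotation \<alpha> ^^ q) z) z = dist (cis ?t) (cis 0)"
      using that by (simp only: dist_norm norm_mult cis_zero) simp
    moreover have "\<bar>?t\<bar> < r"
    proof -
      have "\<bar>?t\<bar> = 2 * pi * \<bar>real q * \<alpha> - of_int p\<bar>" by (simp add: abs_mult)
      also have "\<dots> < 2 * pi * (r / (2 * pi))"
        using q(2) by (intro mult_strict_left_mono) (simp_all add: e'_def)
      finally show ?thesis by simp
    qed
    ultimately show ?thesis using r(2)[of ?t] by (simp only: dist_real_def diff_zero)
  qed
  moreover have "\<bar>birkhoff_sum (circle_rotation \<alpha>) T q z - birkhoff_sum (circle_rotation \<alpha>) T q w\<bar> < e"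
    if zw: "z \<in> sphere 0 1" "w \<in> sphere 0 1" for z w
  proof -
    obtain x y where "z = cis (2 * pi * x)" "w = cis (2 * pi * y)"
      using circle[OF zw(1)] circle[OF zw(2)] by blast
    then show ?thesis using q(3)[of x y] by (simp only: sum) (simp add: e'_def)
  qed
  ultimately show ?thesis using q(1) by blast
qed

text \<open>The criterion for rigid bases is applied with the aperiodic point \<open>1\<close>.
  Smoothness of \<open>T\<close> is expressed through the angle, and its continuity on the circle is
  recovered from there.\<close>

theorem theorem4p11:
  fixes \<alpha> :: real and T :: "complex \<Rightarrow> real"
    and d :: "(complex \<times> real) set \<Rightarrow> (complex \<times> real) set \<Rightarrow> real"
  defines "Y \<equiv> suspension_topology circle (circle_rotation \<alpha>) T"
  assumes irrational: "\<alpha> \<notin> \<rat>"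
    and T_pos: "\<And>z. z \<in> sphere 0 1 \<Longrightarrow> 0 < T z"
    and T_C1: "(\<lambda>\<theta>. T (cis \<theta>)) C1_differentiable_on UNIV"
    and metric: "Metric_space (topspace Y) d"
    and metric_topology: "Metric_space.mtopology (topspace Y) d = Y"
  shows "\<not> kinematic_expansive (topspace Y) d (suspension_flow circle (circle_rotation \<alpha>) T)"
proof -
  have T_cont: "continuous_on (sphere 0 1) T"
    by (intro continuous_on_circle C1_differentiable_imp_continuous_on T_C1)
  have rotation_cont: "continuous_on (sphere 0 1) (circle_rotation \<alpha>)"
    unfolding circle_rotation_def by (intro continuous_intros)
  show ?thesis
    unfolding Y_def
    by (rule not_kinematic_expansive_of_rigid[OF suspension_circle[OF T_pos T_cont] compact_sphere
          rotation_cont T_cont circle_rotation_rigid[OF irrational T_C1] _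
          circle_rotation_aperiodic[OF irrational] metric[unfolded Y_def]
          metric_topology[unfolded Y_def]]) simp_all
qed

end
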